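(* Let $n\ge4$ and let $(\mathfrak{s}^{3}_{n,1},\cdot,[-,-])$ be a transposed Poisson algebra structure on the Lie algebra $\mathfrak{s}^{3}_{n,1}$. Then there are complex numbers $\alpha_3,\dots,\alpha_n,\gamma_1,\gamma_2$ such that the multiplication $\cdot$ is given by $$e_1\cdot e_1=\sum_{t=3}^n\alpha_te_t,\quad e_1\cdot x=\sum_{t=3}^{n-1}(t-2)\alpha_{t+1}e_t+\gamma_1e_n,$$ $$x\cdot x=\sum_{t=3}^{n-2}(t-2)(t-1)\alpha_{t+2}e_t+(n-3)\gamma_1e_{n-1}+\gamma_2e_n,$$ where products of basis elements that are not listed (up to commutativity) are zero.
   Context: All algebras are over $\mathbb{C}$; empty sums are zero. A transposed Poisson algebra is a vector space $\mathfrak{L}$ with bilinear operations $\cdot$ and $[-,-]$ such that $(\mathfrak{L},\cdot)$ is a commutative associative algebra, $(\mathfrak{L},[-,-])$ is a Lie algebra, and $2z\cdot[u,v]=[z\cdot u,v]+[u,z\cdot v]$ for all $u,v,z\in\mathfrak{L}$. A transposed Poisson structure on a Lie algebra $(\mathfrak{L},[-,-])$ is an operation $\cdot$ making $(\mathfrak{L},\cdot,[-,-])$ a transposed Poisson algebra. $\mathfrak{s}^{3}_{n,1}$ is the $(n+1)$-dimensional Lie algebra with basis $e_1,\dots,e_n,x$ and brackets $[e_i,e_1]=e_{i+1}$ for $2\le i\le n-1$; $[e_1,x]=e_1+e_2$; $[e_i,x]=(i-1)e_i$ for $2\le i\le n$; brackets of basis elements not determined by these and antisymmetry are zero. *)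

theory Defs
  imports Complex_Main
begin

text \<open>All algebras are over the complex numbers. The underlying vector space is a whole type
  \<open>'a\<close> with a scalar multiplication \<open>scale\<close>.\<close>

definition bilinear_op ::
  "(complex \<Rightarrow> 'a::ab_group_add \<Rightarrow> 'a) \<Rightarrow> ('a \<Rightarrow> 'a \<Rightarrow> 'a) \<Rightarrow> bool" where
  "bilinear_op scale f \<longleftrightarrow>
     (\<forall>u. Vector_Spaces.linear scale scale (\<lambda>v. f u v)) \<and>
     (\<forall>v. Vector_Spaces.linear scale scale (\<lambda>u. f u v))"

locale complex_lie_algebra = vector_space scale
  for scale :: "complex \<Rightarrow> 'a::ab_group_add \<Rightarrow> 'a" +
  fixes bracket :: "'a \<Rightarrow> 'a \<Rightarrow> 'a"
  assumes bracket_bilinear: "bilinear_op scale bracket"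
    and bracket_self: "bracket u u = 0"
    and jacobi: "bracket u (bracket v w) + bracket v (bracket w u) + bracket w (bracket u v) = 0"

locale transposed_poisson_algebra =
  complex_lie_algebra scale bracket + abel_semigroup mult
  for scale :: "complex \<Rightarrow> 'a::ab_group_add \<Rightarrow> 'a"
    and mult :: "'a \<Rightarrow> 'a \<Rightarrow> 'a"
    and bracket :: "'a \<Rightarrow> 'a \<Rightarrow> 'a" +
  assumes mult_bilinear: "bilinear_op scale mult"
    and transposed_leibniz:
      "scale 2 (mult z (bracket u v)) = bracket (mult z u) v + bracket u (mult z v)"

text \<open>The Lie algebra \<open>\<ss>\<^sup>3\<^bsub>n,1\<^esub>\<close>, presented by its basis \<open>e 1, \<dots>, e n, x\<close> (values \<open>e i\<close> for \<open>i\<close>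
  outside \<open>{1..n}\<close> are irrelevant). The brackets \<open>[e 1, e 1]\<close> and \<open>[x, x]\<close> and those with the
  two arguments exchanged follow from \<open>[u, u] = 0\<close> and bilinearity.\<close>

locale lie_algebra_s3 = complex_lie_algebra scale bracket
  for scale :: "complex \<Rightarrow> 'a::ab_group_add \<Rightarrow> 'a"
    and bracket :: "'a \<Rightarrow> 'a \<Rightarrow> 'a" +
  fixes n :: nat and e :: "nat \<Rightarrow> 'a" and x :: 'a
  assumes basis_inj: "inj_on e {1..n}" "x \<notin> e ` {1..n}"
    and basis_independent: "independent (insert x (e ` {1..n}))"
    and basis_span: "span (insert x (e ` {1..n})) = UNIV"
    and bracket_e_e1: "\<And>i. 2 \<le> i \<Longrightarrow> i \<le> n - 1 \<Longrightarrow> bracket (e i) (e 1) = e (i + 1)"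
    and bracket_e1_x: "bracket (e 1) x = e 1 + e 2"
    and bracket_e_x: "\<And>i. 2 \<le> i \<Longrightarrow> i \<le> n \<Longrightarrow> bracket (e i) x = scale (of_nat (i - 1)) (e i)"
    and bracket_en_e1: "bracket (e n) (e 1) = 0"
    and bracket_e_e: "\<And>i j. 2 \<le> i \<Longrightarrow> i \<le> n \<Longrightarrow> 2 \<le> j \<Longrightarrow> j \<le> n \<Longrightarrow> bracket (e i) (e j) = 0"

end

theory Submission
  imports Defs
begin

text \<open>Multiplication by a fixed element is a linear map \<open>f\<close> with
  \<open>2 f [u, v] = [f u, v] + [u, f v]\<close>. Reading this identity in coordinates on the pairs
  \<open>(e 2, x)\<close>, \<open>(e 2, e 1)\<close>, \<open>(e 3, x)\<close> and \<open>(e 1, x)\<close> shows that \<open>f\<close> is a scalar \<open>a\<close> plus a map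
  that kills \<open>e 2, \<dots>, e n\<close>, sends \<open>e 1\<close> to \<open>\<Sum>t\<ge>3. b t e t\<close> and \<open>x\<close> to
  \<open>\<Sum>t<n. (t - 2) b (t + 1) e t\<close> plus a multiple of \<open>e n\<close>. Commutativity of the product forces
  \<open>a = 0\<close> for every multiplication, and the products with \<open>e 1\<close> and with \<open>x\<close> are related because
  \<open>e 1 \<cdot> x\<close> is the image of \<open>x\<close> under the first and of \<open>e 1\<close> under the second.\<close>

lemma bilinear_opD:
  assumes "bilinear_op scale f"
  shows "f (u + v) w = f u w + f v w" "f w (u + v) = f w u + f w v"
    and "f (scale c u) w = scale c (f u w)" "f w (scale c u) = scale c (f w u)"
  using assms
  by (auto simp: bilinear_op_def Vector_Spaces.linear_iff_module_hom module_hom_iff)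

lemma bilinear_op_linear_right: "bilinear_op scale f \<Longrightarrow> Vector_Spaces.linear scale scale (f u)"
  by (simp add: bilinear_op_def)

section \<open>Coordinates with respect to the basis\<close>

context lie_algebra_s3
begin

abbreviation basis :: "'a set" where
  "basis \<equiv> insert x (e ` {1..n})"

text \<open>Outside \<open>{1..n}\<close> the vector \<open>e i\<close> is arbitrary, so
  \<open>coord i\<close> has its meaning only for \<open>i\<close> in this range.\<close>

definition coord :: "nat \<Rightarrow> 'a \<Rightarrow> complex" where
  "coord i v = representation basis v (e i)"

definition coord_x :: "'a \<Rightarrow> complex" where
  "coord_x v = representation basis v x"

lemma coord_add [simp]: "coord i (u + v) = coord i u + coord i v"
  and coord_x_add [simp]: "coord_x (u + v) = coord_x u + coord_x v"
  and coord_scale [simp]: "coord i (scale c u) = c * coord i u"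
  and coord_x_scale [simp]: "coord_x (scale c u) = c * coord_x u"
  and coord_minus [simp]: "coord i (- u) = - coord i u"
  and coord_x_minus [simp]: "coord_x (- u) = - coord_x u"
  and coord_diff [simp]: "coord i (u - v) = coord i u - coord i v"
  and coord_x_diff [simp]: "coord_x (u - v) = coord_x u - coord_x v"
  and coord_zero [simp]: "coord i 0 = 0"
  and coord_x_zero [simp]: "coord_x 0 = 0"
  using basis_independent basis_span
  by (simp_all add: coord_def coord_x_def representation_add representation_scale
      representation_neg representation_diff representation_zero)

lemma e_neq_x: "1 \<le> i \<Longrightarrow> i \<le> n \<Longrightarrow> e i \<noteq> x"
  using basis_inj(2) by (metis atLeastAtMost_iff imageI)

lemma coord_e [simp]:
  "1 \<le> i \<Longrightarrow> i \<le> n \<Longrightarrow> 1 \<le> j \<Longrightarrow> j \<le> n \<Longrightarrow> coord j (e i) = (if j = i then 1 else 0)"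
  using basis_independent basis_inj(1)
  by (auto simp: coord_def representation_basis inj_on_eq_iff)

lemma coord_x_e [simp]: "1 \<le> i \<Longrightarrow> i \<le> n \<Longrightarrow> coord_x (e i) = 0"
  using basis_independent e_neq_x[of i] by (auto simp: coord_x_def representation_basis)

lemma coord_x_basis [simp]: "1 \<le> j \<Longrightarrow> j \<le> n \<Longrightarrow> coord j x = 0" "coord_x x = 1"
  using basis_independent e_neq_x[of j] by (auto simp: coord_def coord_x_def representation_basis)

lemma basis_induct [case_names zero add scale e x]:
  assumes "P 0" "\<And>u v. P u \<Longrightarrow> P v \<Longrightarrow> P (u + v)" "\<And>c u. P u \<Longrightarrow> P (scale c u)"
    and "\<And>i. i \<in> {1..n} \<Longrightarrow> P (e i)" "P x"
  shows "P v"
proof -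
  have "v \<in> span basis" using basis_span by simp
  then show ?thesis
  proof (induction rule: span_induct)
    case base
    show ?case using assms by (auto intro!: subspaceI)
  next
    case (step b)
    then show ?case using assms by auto
  qed
qed

lemma basis_expansion: "v = (\<Sum>i\<in>{1..n}. scale (coord i v) (e i)) + scale (coord_x v) x"
proof (induction v rule: basis_induct)
  case (add u v)
  have "(\<Sum>i\<in>{1..n}. scale (coord i (u + v)) (e i)) + scale (coord_x (u + v)) x
      = ((\<Sum>i\<in>{1..n}. scale (coord i u) (e i)) + scale (coord_x u) x)
      + ((\<Sum>i\<in>{1..n}. scale (coord i v) (e i)) + scale (coord_x v) x)"
    by (simp add: scale_left_distrib sum.distrib algebra_simps)
  then show ?case using add by metis
next
  case (scale c u)
  have "(\<Sum>i\<in>{1..n}. scale (coord i (scale c u)) (e i)) + scale (coord_x (scale c u)) x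
      = scale c ((\<Sum>i\<in>{1..n}. scale (coord i u) (e i)) + scale (coord_x u) x)"
    by (simp add: scale_right_distrib scale_sum_right)
  then show ?case using scale by metis
next
  case (e i)
  have "(\<Sum>j\<in>{1..n}. scale (coord j (e i)) (e j)) = (\<Sum>j\<in>{1..n}. if j = i then e j else 0)"
    using e by (intro sum.cong) auto
  then show ?case using e by simp
qed simp_all

lemma coord_eqI:
  assumes "\<And>i. i \<in> {1..n} \<Longrightarrow> coord i u = coord i v" "coord_x u = coord_x v"
  shows "u = v"
  by (subst basis_expansion[of u], subst basis_expansion[of v]) (simp add: assms)

lemma coord_sum [simp]: "coord j (\<Sum>t\<in>A. g t) = (\<Sum>t\<in>A. coord j (g t))"
  by (induction A rule: infinite_finite_induct) auto

lemma coord_x_sum [simp]: "coord_x (\<Sum>t\<in>A. g t) = (\<Sum>t\<in>A. coord_x (g t))"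
  by (induction A rule: infinite_finite_induct) auto

text \<open>This is the shape left once \<open>coord j\<close> has been pushed through a sum of
  scaled basis vectors.\<close>

lemma coord_combination:
  assumes "A \<subseteq> {1..n}" "j \<in> {1..n}"
  shows "(\<Sum>t\<in>A. c t * coord j (e t)) = (if j \<in> A then c j else 0)"
proof -
  have "finite A" using assms(1) finite_subset by blast
  have "(\<Sum>t\<in>A. c t * coord j (e t)) = (\<Sum>t\<in>A. if t = j then c t else 0)"
    using assms by (intro sum.cong) auto
  then show ?thesis using \<open>finite A\<close> by simp
qed

lemma coord_x_combination: "A \<subseteq> {1..n} \<Longrightarrow> (\<Sum>t\<in>A. c t * coord_x (e t)) = 0"
  by (intro sum.neutral) auto

section \<open>Brackets with basis elements in coordinates\<close>

lemmas bracket_linear = bilinear_opD[OF bracket_bilinear]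

lemma bracket_zero [simp]: "bracket 0 u = 0" "bracket u 0 = 0"
  using bracket_linear(3)[of 0 0 u] bracket_linear(4)[of u 0 0] by simp_all

lemma bracket_swap: "bracket u v = - bracket v u"
proof -
  have "bracket (u + v) (u + v) = bracket u v + bracket v u"
    by (simp add: bracket_self[of u] bracket_self[of v] bracket_linear(1,2) add.commute)
  then show ?thesis using bracket_self[of "u + v"] by (simp add: eq_neg_iff_add_eq_0)
qed

text \<open>Bracketing with \<open>x\<close> is diagonal except on \<open>e 1\<close>, whose image
  \<open>e 1 + e 2\<close> feeds coordinate 1 into coordinate 2.\<close>

lemma coord_bracket_x:
  assumes "2 \<le> n" "j \<in> {1..n}"
  shows "coord j (bracket w x) =
    (if j = 1 then coord 1 w else if j = 2 then coord 1 w + coord 2 w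
     else of_nat (j - 1) * coord j w)"
proof (induction w rule: basis_induct)
  case (e i)
  then show ?case
    using assms by (cases "i = 1") (auto simp: bracket_e1_x[simplified] bracket_e_x)
next
  case x
  then show ?case using assms bracket_self by simp
qed (use assms in \<open>auto simp: bracket_linear algebra_simps\<close>)

lemma coord_x_bracket_x: "2 \<le> n \<Longrightarrow> coord_x (bracket w x) = 0"
proof (induction w rule: basis_induct)
  case (e i)
  then show ?case by (cases "i = 1") (auto simp: bracket_e1_x[simplified] bracket_e_x)
qed (auto simp: bracket_linear bracket_self)

text \<open>Coordinates 1 and 2 come from \<open>[x, e 1] = - (e 1 + e 2)\<close>, the others from
  the shift of \<open>e i\<close> to \<open>e (i + 1)\<close>, which starts at
  \<open>i = 2\<close>.\<close>

lemma coord_bracket_e1: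
  assumes "2 \<le> n" "j \<in> {1..n}"
  shows "coord j (bracket w (e 1)) = (if j \<le> 2 then - coord_x w else coord (j - 1) w)"
proof (induction w rule: basis_induct)
  case (e i)
  consider "i = 1" | "2 \<le> i" "i \<le> n - 1" | "i = n" using e by force
  then show ?case
    using assms e by cases (auto simp: bracket_self bracket_e_e1[simplified] bracket_en_e1[simplified])
next
  case x
  then show ?case
    using assms by (auto simp: bracket_swap[of x] bracket_e1_x[simplified])
qed (use assms in \<open>auto simp: bracket_linear algebra_simps\<close>)

lemma coord_x_bracket_e1: "2 \<le> n \<Longrightarrow> coord_x (bracket w (e 1)) = 0"
proof (induction w rule: basis_induct)
  case (e i)
  then consider "i = 1" | "2 \<le> i" "i \<le> n - 1" | "i = n" by force
  then show ?case
    using e by cases (auto simp: bracket_self bracket_e_e1[simplified] bracket_en_e1[simplified])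
next
  case x
  then show ?case by (auto simp: bracket_swap[of x] bracket_e1_x[simplified])
qed (auto simp: bracket_linear)

text \<open>For \<open>i = n\<close> the first term would sit at \<open>j = n + 1\<close>, outside
  the range of \<open>j\<close>, in accordance with \<open>[e n, e 1] = 0\<close>.\<close>

lemma coord_bracket_e:
  assumes "i \<in> {2..n}" "j \<in> {1..n}"
  shows "coord j (bracket (e i) w) =
    (if j = i + 1 then coord 1 w else 0) + (if j = i then of_nat (i - 1) * coord_x w else 0)"
proof (induction w rule: basis_induct)
  case (e k)
  show ?case
  proof (cases "k = 1")
    case True
    then show ?thesis using assms coord_bracket_e1[of j "e i"] by auto
  next
    case False
    then show ?thesis using assms e by (auto simp: bracket_e_e)
  qed
next
  case x
  then show ?case using assms by (auto simp: bracket_e_x)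
qed (use assms in \<open>auto simp: bracket_linear algebra_simps\<close>)

lemma coord_x_bracket_e:
  assumes "i \<in> {2..n}"
  shows "coord_x (bracket (e i) w) = 0"
proof (induction w rule: basis_induct)
  case (e k)
  then show ?case
    using assms coord_x_bracket_e1[of "e i"] by (cases "k = 1") (auto simp: bracket_e_e)
qed (use assms in \<open>auto simp: bracket_linear bracket_e_x\<close>)

end

section \<open>Coordinates of a 1/2-derivation\<close>

locale s3_half_derivation = lie_algebra_s3 +
  fixes f :: "'a \<Rightarrow> 'a"
  assumes n_ge_4: "4 \<le> n"
    and f_linear: "Vector_Spaces.linear scale scale f"
    and half_leibniz: "scale 2 (f (bracket u v)) = bracket (f u) v + bracket u (f v)"
begin

lemma f_add: "f (u + v) = f u + f v"
  and f_scale: "f (scale c u) = scale c (f u)"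
  using f_linear by (auto simp: Vector_Spaces.linear_iff_module_hom module_hom_iff)

lemma coord_half_leibniz:
  "2 * coord j (f (bracket u v)) = coord j (bracket (f u) v) + coord j (bracket u (f v))"
  using arg_cong[OF half_leibniz[of u v], of "coord j"] by simp

lemma coord_x_half_leibniz:
  "2 * coord_x (f (bracket u v)) = coord_x (bracket (f u) v) + coord_x (bracket u (f v))"
  using arg_cong[OF half_leibniz[of u v], of coord_x] by simp

text \<open>All diagonal entries of \<open>f\<close> turn out to equal this one.\<close>

definition eigenvalue :: complex where
  "eigenvalue = coord_x (f x)"

lemma coord_f_e2_x:
  assumes "j \<in> {1..n}"
  shows "2 * coord j (f (e 2)) =
    (if j = 1 then coord 1 (f (e 2)) else if j = 2 then coord 1 (f (e 2)) + coord 2 (f (e 2))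
     else of_nat (j - 1) * coord j (f (e 2))) +
    ((if j = 3 then coord 1 (f x) else 0) + (if j = 2 then eigenvalue else 0))"
  using coord_half_leibniz[of j "e 2" x] n_ge_4 assms
  by (simp add: bracket_e_x coord_bracket_x coord_bracket_e eigenvalue_def)

text \<open>The weight \<open>3 - 1\<close> of \<open>e 3\<close> under \<open>x\<close> equals the
  factor 2 on the left, so coordinate 3 of \<open>f (e 2)\<close> cancels and only this term
  remains.\<close>

lemma coord_1_f_x: "coord 1 (f x) = 0"
  using coord_f_e2_x[of 3] n_ge_4 by simp

text \<open>Every weight other than 2 determines its coordinate; coordinate 3 has weight 2 and needs
  the pairs with \<open>e 3\<close>.\<close>

lemma coord_f_e2:
  assumes "j \<in> {1..n}" "j \<noteq> 3"
  shows "coord j (f (e 2)) = (if j = 2 then eigenvalue else 0)"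
proof -
  have 1: "coord 1 (f (e 2)) = 0" using coord_f_e2_x[of 1] n_ge_4 by simp
  consider "j = 1" | "j = 2" | "j > 3" using assms by force
  then show ?thesis
  proof cases
    case 3
    have "(of_nat (j - 1) :: complex) \<noteq> of_nat 2" using 3 unfolding of_nat_eq_iff by simp
    then show ?thesis using 3 coord_f_e2_x[of j] assms(1) by simp
  qed (use 1 coord_f_e2_x[of 2] n_ge_4 in auto)
qed

lemma coord_x_f_e2: "coord_x (f (e 2)) = 0"
  using coord_x_half_leibniz[of "e 2" x] n_ge_4
  by (simp add: bracket_e_x coord_x_bracket_x coord_x_bracket_e)

lemma coord_f_e3:
  assumes "j \<in> {1..n}"
  shows "2 * coord j (f (e 3)) = (if j \<le> 2 then 0 else coord (j - 1) (f (e 2))) +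
    ((if j = 3 then coord 1 (f (e 1)) else 0) + (if j = 2 then coord_x (f (e 1)) else 0))"
  using coord_half_leibniz[of j "e 2" "e 1"] n_ge_4 assms
    coord_bracket_e1[of j "f (e 2)"] coord_bracket_e[of 2 j "f (e 1)"] bracket_e_e1[of 2]
  by (auto simp: coord_x_f_e2)

lemma coord_f_e3_x:
  assumes "j \<in> {2..n}"
  shows "4 * coord j (f (e 3)) =
    (if j = 2 then coord 1 (f (e 3)) + coord 2 (f (e 3))
     else of_nat (j - 1) * coord j (f (e 3))) + (if j = 3 then 2 * eigenvalue else 0)"
  using coord_half_leibniz[of j "e 3" x] n_ge_4 assms coord_1_f_x
  by (simp add: bracket_e_x f_scale coord_bracket_x coord_bracket_e eigenvalue_def)

text \<open>By the pair \<open>(e 2, e 1)\<close> this is twice coordinate 2 of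
  \<open>f (e 3)\<close>, and coordinate 1 of \<open>f (e 3)\<close> is zero;
  \<open>(e 3, x)\<close> then gives \<open>4 c = c\<close> for that coordinate 2.\<close>

lemma coord_x_f_e1: "coord_x (f (e 1)) = 0"
  using coord_f_e3[of 1] coord_f_e3[of 2] coord_f_e3_x[of 2] n_ge_4 by simp

text \<open>Coordinate 3 of \<open>f (e 3)\<close> is computed twice, from \<open>(e 2, e 1)\<close>
  and from \<open>(e 3, x)\<close>.\<close>

lemma coord_1_f_e1: "coord 1 (f (e 1)) = eigenvalue"
proof -
  have "2 * coord 3 (f (e 3)) = eigenvalue + coord 1 (f (e 1))"
    using coord_f_e3[of 3] coord_f_e2[of 2] n_ge_4 by simp
  moreover have "4 * coord 3 (f (e 3)) = 2 * coord 3 (f (e 3)) + 2 * eigenvalue"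
    using coord_f_e3_x[of 3] n_ge_4 by simp
  ultimately show ?thesis by algebra
qed

lemma f_e2: "f (e 2) = scale eigenvalue (e 2)"
proof (rule coord_eqI)
  fix j assume j: "j \<in> {1..n}"
  \<comment> \<open>This coordinate is twice coordinate 4 of \<open>f (e 3)\<close>, for which
    \<open>(e 3, x)\<close> gives \<open>4 c = 3 c\<close>. Here \<open>4 \<le> n\<close> is
    essential.\<close>
  have "coord 3 (f (e 2)) = 0"
    using coord_f_e3[of 4] coord_f_e3_x[of 4] n_ge_4 by simp
  then show "coord j (f (e 2)) = coord j (scale eigenvalue (e 2))"
    using j coord_f_e2[of j] n_ge_4 by (cases "j = 3") auto
qed (use coord_x_f_e2 n_ge_4 in auto)

lemma f_e: "2 \<le> i \<Longrightarrow> i \<le> n \<Longrightarrow> f (e i) = scale eigenvalue (e i)"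
proof (induction i rule: nat_induct_at_least)
  case base
  show ?case by (rule f_e2)
next
  case (Suc i)
  have IH: "f (e i) = scale eigenvalue (e i)" using Suc.IH Suc.prems by simp
  have br: "bracket (e i) (e 1) = e (Suc i)" using Suc.hyps Suc.prems bracket_e_e1[of i] by simp
  \<comment> \<open>\<open>[f (e i), e 1]\<close> and \<open>[e i, f (e 1)]\<close> each contribute
    \<open>eigenvalue\<close> times \<open>e (Suc i)\<close>.\<close>
  have "2 * coord j (f (e (Suc i))) = 2 * coord j (scale eigenvalue (e (Suc i)))"
    if "j \<in> {1..n}" for j
    using coord_half_leibniz[of j "e i" "e 1"] Suc.hyps Suc.prems that
      coord_bracket_e[of i j "f (e 1)"] coord_x_f_e1 coord_1_f_e1
    by (auto simp: IH bracket_linear br simp del: One_nat_def)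
  moreover have "2 * coord_x (f (e (Suc i))) = 0"
    using coord_x_half_leibniz[of "e i" "e 1"] Suc.hyps Suc.prems coord_x_bracket_e[of i "f (e 1)"]
    by (simp add: IH bracket_linear br del: One_nat_def)
  ultimately show ?case using Suc.hyps Suc.prems by (intro coord_eqI) auto
qed

lemma coord_f_e1_x:
  assumes "j \<in> {2..n}"
  shows "2 * coord j (f (e 1)) + 2 * coord j (f (e 2)) =
    (if j = 2 then eigenvalue + coord 2 (f (e 1)) else of_nat (j - 1) * coord j (f (e 1)))
    + (if j = 2 then eigenvalue else - coord (j - 1) (f x))"
  using coord_half_leibniz[of j "e 1" x] n_ge_4 assms
    bracket_swap[of "e 1" "f x"] coord_bracket_e1[of j "f x"] coord_1_f_e1 bracket_e1_x
  by (auto simp: f_add coord_bracket_x eigenvalue_def algebra_simps)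

lemma coord_2_f_e1: "coord 2 (f (e 1)) = 0"
  using coord_f_e1_x[of 2] n_ge_4 by (simp add: f_e2)

text \<open>Coordinate \<open>t + 1\<close> on the pair \<open>(e 1, x)\<close>: the bracket with
  \<open>e 1\<close> shifts \<open>f x\<close> by one index, and \<open>t - 2\<close> is the weight
  of \<open>e (t + 1)\<close> minus 2. Coordinate \<open>n\<close> of \<open>f x\<close> would be
  shifted out of range, so it stays free.\<close>

lemma coord_f_x:
  assumes "t \<in> {2..n - 1}"
  shows "coord t (f x) = of_nat (t - 2) * coord (t + 1) (f (e 1))"
proof -
  have "2 * coord (t + 1) (f (e 1)) = of_nat t * coord (t + 1) (f (e 1)) - coord t (f x)"
    using coord_f_e1_x[of "t + 1"] assms n_ge_4 by (auto simp: f_e2)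
  then show ?thesis using assms by (simp add: of_nat_diff algebra_simps)
qed

lemma f_e1_eq:
  assumes "eigenvalue = 0"
  shows "f (e 1) = (\<Sum>t=3..n. scale (coord t (f (e 1))) (e t))"
proof (rule coord_eqI)
  fix j assume j: "j \<in> {1..n}"
  consider "j = 1" | "j = 2" | "j \<ge> 3" using j by force
  then show "coord j (f (e 1)) = coord j (\<Sum>t=3..n. scale (coord t (f (e 1))) (e t))"
    using j assms coord_1_f_e1 coord_2_f_e1 by cases (auto simp: coord_combination simp del: coord_e)
qed (use coord_x_f_e1 in \<open>simp add: coord_x_combination\<close>)

text \<open>The sum starts at 3 because the factor \<open>t - 2\<close> vanishes at 2.\<close>

lemma f_x_eq:
  assumes "eigenvalue = 0"
  shows "f x = (\<Sum>t=3..n-1. scale (of_nat (t - 2) * coord (t + 1) (f (e 1))) (e t))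
    + scale (coord n (f x)) (e n)"
proof (rule coord_eqI)
  fix j assume j: "j \<in> {1..n}"
  consider "j = 1" | "j = 2" | "j \<ge> 3" "j \<le> n - 1" | "j = n" using j by force
  then show "coord j (f x) = coord j ((\<Sum>t=3..n-1. scale (of_nat (t - 2) *
      coord (t + 1) (f (e 1))) (e t)) + scale (coord n (f x)) (e n))"
    using j n_ge_4 coord_1_f_x coord_f_x[of j]
    by cases (auto simp: coord_combination)
qed (use n_ge_4 assms in \<open>simp add: coord_x_combination eigenvalue_def\<close>)

end

section \<open>The multiplication table\<close>

theorem theorem3p4:
  fixes scale :: "complex \<Rightarrow> 'a::ab_group_add \<Rightarrow> 'a"
    and mult bracket :: "'a \<Rightarrow> 'a \<Rightarrow> 'a"
    and n :: nat and e :: "nat \<Rightarrow> 'a" and x :: 'a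
  assumes "n \<ge> 4"
    and "lie_algebra_s3 scale bracket n e x"
    and "transposed_poisson_algebra scale mult bracket"
  shows "\<exists>(\<alpha> :: nat \<Rightarrow> complex) (\<gamma>1 :: complex) (\<gamma>2 :: complex).
    mult (e 1) (e 1) = (\<Sum>t=3..n. scale (\<alpha> t) (e t)) \<and>
    mult (e 1) x =
      (\<Sum>t=3..n-1. scale (of_nat (t - 2) * \<alpha> (t + 1)) (e t)) + scale \<gamma>1 (e n) \<and>
    mult x x =
      (\<Sum>t=3..n-2. scale (of_nat (t - 2) * of_nat (t - 1) * \<alpha> (t + 2)) (e t))
        + scale (of_nat (n - 3) * \<gamma>1) (e (n - 1)) + scale \<gamma>2 (e n) \<and>
    (\<forall>i\<in>{1..n}. \<forall>j\<in>{1..n}. (i, j) \<noteq> (1, 1) \<longrightarrow> mult (e i) (e j) = 0) \<and>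
    (\<forall>i\<in>{2..n}. mult (e i) x = 0)"
proof -
  interpret L: lie_algebra_s3 scale bracket n e x by fact
  interpret T: transposed_poisson_algebra scale mult bracket by fact
  have H: "s3_half_derivation scale bracket n e x (mult z)" for z
    using assms(1) T.transposed_leibniz bilinear_op_linear_right[OF T.mult_bilinear]
    by (intro s3_half_derivation.intro s3_half_derivation_axioms.intro assms(2)) auto
  define a where "a z = L.coord_x (mult z x)" for z
  have a: "s3_half_derivation.eigenvalue scale n e x (mult z) = a z" for z
    unfolding s3_half_derivation.eigenvalue_def[OF H] a_def ..
  have me: "mult z (e i) = scale (a z) (e i)" if "i \<in> {2..n}" for z i
    using s3_half_derivation.f_e[OF H, of i z] that by (simp add: a)
  \<comment> \<open>By commutativity \<open>a (e i)\<close> is the \<open>x\<close>-coordinate of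
    \<open>mult x (e i)\<close>, a multiple of \<open>e i\<close>.\<close>
  have a_e: "a (e i) = 0" if "i \<in> {2..n}" for i
    using arg_cong[OF me[OF that, of x], of L.coord_x] that
    by (simp add: a_def T.commute[of x "e i"])
  have a_e1: "a (e 1) = 0"
    using s3_half_derivation.coord_x_f_e1[OF H, of x] by (simp add: a_def T.commute[of x "e 1"] del: One_nat_def)
  \<comment> \<open>Coordinate 1 of the product of \<open>e 1\<close> and \<open>x\<close> is
    \<open>a x\<close> as an image under \<open>mult x\<close>, and 0 as the image of
    \<open>x\<close> under \<open>mult (e 1)\<close>.\<close>
  have a_x: "a x = 0"
    using s3_half_derivation.coord_1_f_e1[OF H, of x] s3_half_derivation.coord_1_f_x[OF H, of "e 1"]
    by (simp add: a T.commute[of x "e 1"] del: One_nat_def)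
  define \<alpha> where "\<alpha> t = L.coord t (mult (e 1) (e 1))" for t
  define \<gamma>1 where "\<gamma>1 = L.coord n (mult (e 1) x)"
  define \<gamma>2 where "\<gamma>2 = L.coord n (mult x x)"
  have zero: "mult z (e i) = 0" if "i \<in> {2..n}" "z \<in> insert x (e ` {1..n})" for z i
  proof -
    have "a (e k) = 0" if "k \<in> {1..n}" for k
      using that a_e[of k] a_e1 by (cases "k = 1") auto
    then have "a z = 0" using that(2) a_x by blast
    then show ?thesis using me[OF that(1)] by simp
  qed
  have 1: "mult (e 1) (e 1) = (\<Sum>t=3..n. scale (\<alpha> t) (e t))"
    unfolding \<alpha>_def by (rule s3_half_derivation.f_e1_eq[OF H]) (simp only: a a_e1)
  have 2: "mult (e 1) x =
      (\<Sum>t=3..n-1. scale (of_nat (t - 2) * \<alpha> (t + 1)) (e t)) + scale \<gamma>1 (e n)"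
    unfolding \<alpha>_def \<gamma>1_def by (rule s3_half_derivation.f_x_eq[OF H]) (simp only: a a_e1)
  \<comment> \<open>The relation between the images of \<open>x\<close> and \<open>e 1\<close> under
    \<open>mult (e 1)\<close>, taken at index \<open>t + 1\<close>, has the factor
    \<open>(t + 1) - 2\<close>.\<close>
  have \<beta>: "L.coord (t + 1) (mult x (e 1)) = of_nat (t - 1) * \<alpha> (t + 2)" if "t \<in> {3..n-2}" for t
  proof -
    have "t + 1 \<in> {2..n-1}" using that by auto
    from s3_half_derivation.coord_f_x[OF H this, of "e 1"] show ?thesis
      by (simp only: \<alpha>_def T.commute[of x "e 1"] add.assoc one_add_one) simp
  qed
  \<comment> \<open>The top index is split off: its term involves coordinate \<open>n\<close> of
    \<open>mult x (e 1)\<close>, which is the free parameter \<open>\<gamma>1\<close>.\<close>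
  have "{3..n-1} = insert (n - 1) {3..n-2}" "n - 1 \<notin> {3..n-2}"
    "n - 1 - 2 = n - 3" "n - 1 + 1 = n" using assms(1) by auto
  then have "(\<Sum>t=3..n-1. scale (of_nat (t - 2) * L.coord (t + 1) (mult x (e 1))) (e t))
      = scale (of_nat (n - 3) * \<gamma>1) (e (n - 1))
      + (\<Sum>t=3..n-2. scale (of_nat (t - 2) * L.coord (t + 1) (mult x (e 1))) (e t))"
    by (simp only: sum.insert finite_atLeastAtMost \<gamma>1_def T.commute[of x "e 1"]) simp
  also have "(\<Sum>t=3..n-2. scale (of_nat (t - 2) * L.coord (t + 1) (mult x (e 1))) (e t))
      = (\<Sum>t=3..n-2. scale (of_nat (t - 2) * of_nat (t - 1) * \<alpha> (t + 2)) (e t))"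
    using \<beta> by (intro sum.cong) (auto simp: mult.assoc)
  finally have sum_x: "(\<Sum>t=3..n-1. scale (of_nat (t - 2) * L.coord (t + 1) (mult x (e 1))) (e t))
      = scale (of_nat (n - 3) * \<gamma>1) (e (n - 1))
      + (\<Sum>t=3..n-2. scale (of_nat (t - 2) * of_nat (t - 1) * \<alpha> (t + 2)) (e t))" .
  have "mult x x = (\<Sum>t=3..n-1. scale (of_nat (t - 2) * L.coord (t + 1) (mult x (e 1))) (e t))
      + scale \<gamma>2 (e n)"
    unfolding \<gamma>2_def by (rule s3_half_derivation.f_x_eq[OF H]) (simp only: a a_x)
  then have 3: "mult x x =
      (\<Sum>t=3..n-2. scale (of_nat (t - 2) * of_nat (t - 1) * \<alpha> (t + 2)) (e t))
        + scale (of_nat (n - 3) * \<gamma>1) (e (n - 1)) + scale \<gamma>2 (e n)"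
    unfolding sum_x by (simp only: add.commute)
  have 4: "mult (e i) (e j) = 0" if "i \<in> {1..n}" "j \<in> {1..n}" "(i, j) \<noteq> (1, 1)" for i j
  proof (cases "j = 1")
    case True
    \<comment> \<open>Here \<open>i \<ge> 2\<close>, so commutativity brings the annihilated factor
      \<open>e i\<close> to the right.\<close>
    then show ?thesis using that zero[of i "e j"] T.commute[of "e i" "e j"] by simp
  next
    case False
    then show ?thesis using that zero[of j "e i"] by simp
  qed
  have 5: "mult (e i) x = 0" if "i \<in> {2..n}" for i
    using zero[OF that, of x] by (simp add: T.commute[of "e i" x])
  show ?thesis using 1 2 3 4 5 by blast
qed

end
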